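(* Let $n\geqslant 2$ be an integer. Let $S\supset \mathbb{Z}/n\mathbb{Z}$ be a faithful, finite, associative, commutative $\mathbb{Z}/n\mathbb{Z}$-algebra with unit. Let $\sigma$ be a $\mathbb{Z}/n\mathbb{Z}$-algebra endomorphism of $S$. Let $\Omega\subset S$ be a subset such that the smallest $\mathbb{Z}/n\mathbb{Z}$-subalgebra of $S$ containing $\Omega$ and stable under $\sigma$ is $S$ itself. Assume $\omega^n=\sigma(\omega)$ for every $\omega\in\Omega$. If $n$ is prime, then $x^n=\sigma(x)$ for every $x\in S$. *)

theory Defs
  imports "HOL-Number_Theory.Residues" "HOL-Algebra.Module" "HOL-Algebra.Subrings"
begin

definition faithful_algebra :: "('a, 'm) ring_scheme \<Rightarrow> ('a, 'b, 'k) module_scheme \<Rightarrow> bool"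
  where "faithful_algebra R S \<longleftrightarrow>
    algebra R S \<and> (\<forall>a\<in>carrier R. (\<forall>x\<in>carrier S. a \<odot>\<^bsub>S\<^esub> x = \<zero>\<^bsub>S\<^esub>) \<longrightarrow> a = \<zero>\<^bsub>R\<^esub>)"

definition algebra_endo :: "('a, 'm) ring_scheme \<Rightarrow> ('a, 'b, 'k) module_scheme \<Rightarrow> ('b \<Rightarrow> 'b) set"
  where "algebra_endo R S =
    {\<sigma> \<in> ring_hom S S. \<forall>a\<in>carrier R. \<forall>x\<in>carrier S. \<sigma> (a \<odot>\<^bsub>S\<^esub> x) = a \<odot>\<^bsub>S\<^esub> \<sigma> x}"

text \<open>The library locale \<open>subalgebra\<close> only asks for a submodule; here closure under
  multiplication and membership of the unit are required as well.\<close>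

definition unital_subalgebra ::
    "'b set \<Rightarrow> ('a, 'm) ring_scheme \<Rightarrow> ('a, 'b, 'k) module_scheme \<Rightarrow> bool"
  where "unital_subalgebra T R S \<longleftrightarrow> submodule T R S \<and> subring T S"

definition stable_subalgebras ::
    "('a, 'm) ring_scheme \<Rightarrow> ('a, 'b, 'k) module_scheme \<Rightarrow> ('b \<Rightarrow> 'b) \<Rightarrow> 'b set \<Rightarrow> 'b set set"
  where "stable_subalgebras R S \<sigma> \<Omega> =
    {T. unital_subalgebra T R S \<and> \<Omega> \<subseteq> T \<and> \<sigma> ` T \<subseteq> T}"

definition stable_closure ::
    "('a, 'm) ring_scheme \<Rightarrow> ('a, 'b, 'k) module_scheme \<Rightarrow> ('b \<Rightarrow> 'b) \<Rightarrow> 'b set \<Rightarrow> 'b set"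
  where "stable_closure R S \<sigma> \<Omega> = \<Inter>(stable_subalgebras R S \<sigma> \<Omega>)"

lemma stable_closure_least:
  assumes "T \<in> stable_subalgebras R S \<sigma> \<Omega>"
  shows "stable_closure R S \<sigma> \<Omega> \<subseteq> T"
  using assms by (auto simp: stable_closure_def)

lemma stable_closure_mem:
  assumes alg: "algebra R S" and \<sigma>: "\<sigma> \<in> algebra_endo R S" and \<Omega>: "\<Omega> \<subseteq> carrier S"
  shows "stable_closure R S \<sigma> \<Omega> \<in> stable_subalgebras R S \<sigma> \<Omega>"
proof -
  interpret algebra R S by (rule alg)
  have rS: "ring S"
    using M_cring by (rule cring.axioms(1))
  let ?F = "stable_subalgebras R S \<sigma> \<Omega>"
  have top: "carrier S \<in> ?F"
  proof -
    have "subring (carrier S) S"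
      using rS by (rule ring.carrier_is_subring)
    moreover have "submodule (carrier S) R S"
      by (rule submoduleI) auto
    moreover have "\<sigma> ` carrier S \<subseteq> carrier S"
      using \<sigma> by (auto simp: algebra_endo_def ring_hom_def)
    ultimately show ?thesis
      using \<Omega> by (simp add: stable_subalgebras_def unital_subalgebra_def)
  qed
  have sr: "subring T S" if "T \<in> ?F" for T
    using that by (simp add: stable_subalgebras_def unital_subalgebra_def)
  have sm: "submodule T R S" if "T \<in> ?F" for T
    using that by (simp add: stable_subalgebras_def unital_subalgebra_def)
  have "subring (\<Inter>?F) S"
    by (rule ring.subring_Inter[OF rS]) (use sr top in auto)
  moreover have "submodule (\<Inter>?F) R S"
    using top sr sm by (intro submoduleI) (auto simp: subringE intro: submodule.smult_closed[where R = R])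
  moreover have "\<Omega> \<subseteq> \<Inter>?F" "\<sigma> ` \<Inter>?F \<subseteq> \<Inter>?F"
    by (auto simp: stable_subalgebras_def)
  ultimately show ?thesis
    unfolding stable_closure_def by (simp add: stable_subalgebras_def unital_subalgebra_def)
qed

end

theory Submission
  imports Defs
begin

text \<open>In characteristic \<open>n\<close> prime, \<open>x \<mapsto> x ^ n\<close> is a ring endomorphism commuting with every ring
  endomorphism, and it is linear by Fermat's little theorem. Hence the elements on which it agrees
  with \<open>\<sigma>\<close> form a \<open>\<sigma>\<close>-stable subalgebra, which contains \<open>\<Omega>\<close> and is therefore everything.\<close>

text \<open>Induction on the exponent: multiplying the expansion by \<open>x\<close> shifts the
  index of each monomial, multiplying by \<open>y\<close> keeps it, and Pascal's rule merges the two
  sums.\<close>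

theorem (in cring) binomial_expansion:
  assumes x: "x \<in> carrier R" and y: "y \<in> carrier R"
  shows "(x \<oplus> y) [^] (n::nat) =
    (\<Oplus>k\<in>{..n}. [(n choose k)] \<cdot> (x [^] k \<otimes> y [^] (n - k)))"
proof (induction n)
  case 0
  then show ?case by simp
next
  case (Suc n)
  \<comment> \<open>The monomials of total degree \<open>Suc n\<close>, in which both products
    \<open>?A \<otimes> x\<close> and \<open>?A \<otimes> y\<close> are expressed.\<close>
  define t where "t k = x [^] k \<otimes> y [^] (Suc n - k)" for k
  have t: "t k \<in> carrier R" for k
    using x y by (simp add: t_def)
  let ?A = "\<Oplus>k\<in>{..n}. [(n choose k)] \<cdot> (x [^] k \<otimes> y [^] (n - k))"
  have "?A \<otimes> x = (\<Oplus>k\<in>{..n}. [(n choose k)] \<cdot> (x [^] k \<otimes> y [^] (n - k)) \<otimes> x)"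
    using x y by (intro finsum_ldistr) auto
  also have "\<dots> = (\<Oplus>k\<in>{..n}. [(n choose k)] \<cdot> t (Suc k))"
    using x y by (intro finsum_cong') (auto simp: t_def add_pow_rdistr m_ac)
  finally have Ax: "?A \<otimes> x = (\<Oplus>k\<in>{..n}. [(n choose k)] \<cdot> t (Suc k))" .
  have "?A \<otimes> y = (\<Oplus>k\<in>{..n}. [(n choose k)] \<cdot> (x [^] k \<otimes> y [^] (n - k)) \<otimes> y)"
    using x y by (intro finsum_ldistr) auto
  also have "\<dots> = (\<Oplus>k\<in>{..n}. [(n choose k)] \<cdot> t k)"
    using x y by (intro finsum_cong') (auto simp: t_def add_pow_ldistr m_assoc Suc_diff_le)
  \<comment> \<open>The added top term has coefficient \<open>n choose Suc n\<close>, which is 0.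
    Splitting off the term at 0 next leaves the same index range as in \<open>Ax\<close>.\<close>
  also have "\<dots> = (\<Oplus>k\<in>{..Suc n}. [(n choose k)] \<cdot> t k)"
    using t by (subst finsum_Suc) (auto simp: binomial_eq_0)
  also have "\<dots> = (\<Oplus>k\<in>{..n}. [(n choose Suc k)] \<cdot> t (Suc k)) \<oplus> t 0"
    using t by (subst finsum_Suc2) auto
  finally have Ay: "?A \<otimes> y = (\<Oplus>k\<in>{..n}. [(n choose Suc k)] \<cdot> t (Suc k)) \<oplus> t 0" .
  \<comment> \<open>Pascal's rule splits each coefficient \<open>Suc n choose Suc k\<close>.\<close>
  have "(\<Oplus>k\<in>{..Suc n}. [(Suc n choose k)] \<cdot> t k)
      = (\<Oplus>k\<in>{..n}. [(n choose k)] \<cdot> t (Suc k) \<oplus> [(n choose Suc k)] \<cdot> t (Suc k)) \<oplus> t 0"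
    using t by (subst finsum_Suc2) (auto simp: add.nat_pow_mult)
  also have "\<dots> = ?A \<otimes> x \<oplus> ?A \<otimes> y"
    using t by (subst finsum_addf) (auto simp: Ax Ay a_assoc)
  also have "\<dots> = ?A \<otimes> (x \<oplus> y)"
    using x y by (subst r_distr) auto
  finally show ?case
    using Suc by (simp add: t_def)
qed

text \<open>A prime \<open>p\<close> divides \<open>p choose k\<close> for \<open>0 < k < p\<close>,
  so only the two extreme terms of the binomial expansion survive.\<close>

corollary (in cring) prime_power_add:
  fixes p :: nat
  assumes p: "prime p" and char: "\<And>z. z \<in> carrier R \<Longrightarrow> [p] \<cdot> z = \<zero>"
    and x: "x \<in> carrier R" and y: "y \<in> carrier R"
  shows "(x \<oplus> y) [^] p = x [^] p \<oplus> y [^] p"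
proof -
  define f where "f k = [(p choose k)] \<cdot> (x [^] k \<otimes> y [^] (p - k))" for k
  have f: "f \<in> A \<rightarrow> carrier R" for A
    using x y by (auto simp: f_def)
  have f0: "f k = \<zero>" if k: "0 < k" "k < p" for k
  proof -
    have "p dvd p choose k"
      by (rule dvd_choose_prime) (use p k in auto)
    then obtain c where "p choose k = p * c"
      by blast
    then have "f k = [c] \<cdot> ([p] \<cdot> (x [^] k \<otimes> y [^] (p - k)))"
      using x y by (simp add: f_def add.nat_pow_pow)
    then show ?thesis
      using x y by (simp add: char)
  qed
  \<comment> \<open>With \<open>p = Suc q\<close> the top term splits off, and the remaining sum up
    to \<open>q\<close> collapses to its term at 0.\<close>
  obtain q where q: "p = Suc q" "q > 0"
    using prime_gt_1_nat[OF p] by (cases p) auto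
  have "(\<Oplus>k\<in>{..q}. f k) = (\<Oplus>k\<in>{0}. f k)"
    using f f0 q by (intro add.finprod_mono_neutral_cong_right) auto
  then have "(\<Oplus>k\<in>{..p}. f k) = f p \<oplus> f 0"
    using f[of "{..Suc q}"] f[of "{0}"] by (auto simp: q)
  then show ?thesis
    using x y binomial_expansion[OF x y, of p] by (simp add: f_def)
qed

text \<open>Commutativity of \<open>M\<close> allows the scalars to be collected in front. With
  Fermat's little theorem this makes the power map linear.\<close>

lemma algebra_smult_nat_pow:
  fixes R (structure) and M (structure)
  assumes alg: "algebra R M" and "a \<in> carrier R" "x \<in> carrier M"
  shows "(a \<odot>\<^bsub>M\<^esub> x) [^]\<^bsub>M\<^esub> (k::nat) = (a [^]\<^bsub>R\<^esub> k) \<odot>\<^bsub>M\<^esub> (x [^]\<^bsub>M\<^esub> k)"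
proof -
  interpret M: cring M by (rule algebra.M_cring[OF alg])
  interpret algebra R M by (rule alg)
  show ?thesis
  proof (induction k)
    case (Suc k)
    have "(a [^]\<^bsub>R\<^esub> k \<odot>\<^bsub>M\<^esub> x [^]\<^bsub>M\<^esub> k) \<otimes>\<^bsub>M\<^esub> (a \<odot>\<^bsub>M\<^esub> x)
        = a [^]\<^bsub>R\<^esub> k \<odot>\<^bsub>M\<^esub> ((a \<odot>\<^bsub>M\<^esub> x) \<otimes>\<^bsub>M\<^esub> x [^]\<^bsub>M\<^esub> k)"
      using assms M.m_comm[of "x [^]\<^bsub>M\<^esub> k" "a \<odot>\<^bsub>M\<^esub> x"] by (simp add: smult_assoc2)
    also have "\<dots> = (a [^]\<^bsub>R\<^esub> Suc k) \<odot>\<^bsub>M\<^esub> (x [^]\<^bsub>M\<^esub> Suc k)"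
      using assms M.m_comm[of "x [^]\<^bsub>M\<^esub> k" x] by (simp add: smult_assoc1 smult_assoc2)
    finally show ?case
      using Suc by simp
  qed (simp add: assms)
qed

lemma residue_ring_nat_pow_prime:
  assumes p: "prime p" and a: "a \<in> carrier (residue_ring (int p))"
  shows "a [^]\<^bsub>residue_ring (int p)\<^esub> p = a"
proof -
  interpret residues "int p" "residue_ring (int p)"
    using prime_gt_1_nat[OF p] by unfold_locales auto
  have a': "0 \<le> a" "a < int p"
    using a by (auto simp: res_carrier_eq)
  have "[a ^ p = a] (mod int p)"
  proof (cases "a = 0")
    case True
    then show ?thesis
      using p by (simp add: prime_gt_0_nat power_0_left)
  next
    case False
    then have "\<not> p dvd nat a"
      using a' by (auto dest: dvd_imp_le)
    \<comment> \<open>Fermat's theorem gives exponent \<open>p - 1\<close> for a unit; one more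
      factor \<open>nat a\<close> yields exponent \<open>p\<close>.\<close>
    then have "[nat a ^ (p - 1) * nat a = 1 * nat a] (mod p)"
      by (intro cong_mult fermat_theorem p) auto
    then have "[nat a ^ p = nat a] (mod p)"
      using p by (simp only: power_minus_mult prime_gt_0_nat mult_1)
    then have "[int (nat a ^ p) = int (nat a)] (mod int p)"
      by (simp only: cong_int_iff)
    then show ?thesis
      using a' by simp
  qed
  then show ?thesis
    using pow_cong[of a p] a' by (simp add: cong_def)
qed

text \<open>Adding \<open>n\<close> copies of \<open>x\<close> amounts to scaling by the residue of
  \<open>n\<close>, which is 0. This supplies the characteristic hypothesis of
  \<open>prime_power_add\<close>.\<close>

lemma residue_algebra_add_pow_eq_zero:
  assumes n: "n \<ge> 2" and alg: "algebra (residue_ring (int n)) S" and x: "x \<in> carrier S"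
  shows "[n] \<cdot>\<^bsub>S\<^esub> x = \<zero>\<^bsub>S\<^esub>"
proof -
  let ?R = "residue_ring (int n)"
  interpret R: residues "int n" ?R
    using n by unfold_locales auto
  interpret S: cring S by (rule algebra.M_cring[OF alg])
  interpret algebra ?R S by (rule alg)
  \<comment> \<open>Stated for every \<open>k\<close> so that induction applies; the reduction mod
    \<open>n\<close> keeps the scalar in the carrier.\<close>
  have "[k] \<cdot>\<^bsub>S\<^esub> x = (int k mod int n) \<odot>\<^bsub>S\<^esub> x" for k
  proof (induction k)
    case 0
    then show ?case
      using x smult_l_null[of x] by (simp add: R.res_zero_eq)
  next
    case (Suc k)
    have "(int (Suc k) mod int n) \<odot>\<^bsub>S\<^esub> x
        = ((int k mod int n) \<oplus>\<^bsub>?R\<^esub> \<one>\<^bsub>?R\<^esub>) \<odot>\<^bsub>S\<^esub> x"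
      by (simp add: R.one_cong R.add_cong add.commute)
    also have "\<dots> = (int k mod int n) \<odot>\<^bsub>S\<^esub> x \<oplus>\<^bsub>S\<^esub> x"
      using x by (subst smult_l_distr) auto
    finally show ?case
      using Suc by simp
  qed
  then show ?thesis
    using x smult_l_null[of x] by (simp add: R.res_zero_eq)
qed

theorem theorem2:
  fixes n :: nat
    and S :: "(int, 'a, 'm) module_scheme"
    and \<sigma> :: "'a \<Rightarrow> 'a"
    and \<Omega> :: "'a set"
  assumes "n \<ge> 2"
    and "faithful_algebra (residue_ring (int n)) S"
    and "finite (carrier S)"
    and "\<sigma> \<in> algebra_endo (residue_ring (int n)) S"
    and "\<Omega> \<subseteq> carrier S"
    and "stable_closure (residue_ring (int n)) S \<sigma> \<Omega> = carrier S"
    and "\<And>\<omega>. \<omega> \<in> \<Omega> \<Longrightarrow> \<omega> [^]\<^bsub>S\<^esub> n = \<sigma> \<omega>"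
    and "prime n"
  shows "\<forall>x\<in>carrier S. x [^]\<^bsub>S\<^esub> n = \<sigma> x"
proof -
  let ?R = "residue_ring (int n)"
  have alg: "algebra ?R S"
    using assms(2) by (simp add: faithful_algebra_def)
  interpret S: cring S by (rule algebra.M_cring[OF alg])
  interpret algebra ?R S by (rule alg)
  have \<sigma>: "\<sigma> \<in> ring_hom S S"
    and \<sigma>_smult: "\<And>a x. a \<in> carrier ?R \<Longrightarrow> x \<in> carrier S \<Longrightarrow> \<sigma> (a \<odot>\<^bsub>S\<^esub> x) = a \<odot>\<^bsub>S\<^esub> \<sigma> x"
    using assms(4) by (auto simp: algebra_endo_def)
  interpret \<sigma>: ring_hom_cring S S \<sigma>
    by unfold_locales (rule \<sigma>)
  define T where "T = {x \<in> carrier S. x [^]\<^bsub>S\<^esub> n = \<sigma> x}"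
  have add: "x \<oplus>\<^bsub>S\<^esub> y \<in> T" if "x \<in> T" "y \<in> T" for x y
    using that S.prime_power_add[OF assms(8) residue_algebra_add_pow_eq_zero[OF assms(1) alg]]
    by (simp add: T_def)
  have smult: "a \<odot>\<^bsub>S\<^esub> x \<in> T" if "a \<in> carrier ?R" "x \<in> T" for a x
    using that residue_ring_nat_pow_prime[OF assms(8)] by (simp add: T_def algebra_smult_nat_pow[OF alg] \<sigma>_smult)
  \<comment> \<open>Treating negation as scaling by the residue -1 avoids a case split on the parity
    of \<open>n\<close>.\<close>
  have neg: "\<ominus>\<^bsub>S\<^esub> x \<in> T" if "x \<in> T" for x
  proof -
    have "\<ominus>\<^bsub>S\<^esub> x = (\<ominus>\<^bsub>?R\<^esub> \<one>\<^bsub>?R\<^esub>) \<odot>\<^bsub>S\<^esub> x"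
      using that smult_l_minus[of "\<one>\<^bsub>?R\<^esub>" x] by (simp add: T_def)
    then show ?thesis
      using that by (simp add: smult)
  qed
  have "subring T S"
    by (rule S.subringI) (use add neg in \<open>auto simp: T_def S.nat_pow_distrib\<close>)
  moreover have "submodule T ?R S"
    using add neg smult subringE(1,2)[OF \<open>subring T S\<close>]
    by (intro submoduleI) auto
  moreover have "\<Omega> \<subseteq> T"
    using assms(5,7) by (auto simp: T_def)
  \<comment> \<open>For \<open>x\<close> in \<open>T\<close>, applying \<open>\<sigma>\<close> to
    both sides of the defining equation gives the same equation for
    \<open>\<sigma> x\<close>.\<close>
  moreover have "\<sigma> ` T \<subseteq> T"
    by (auto simp: T_def simp flip: \<sigma>.hom_pow)
  ultimately have "T \<in> stable_subalgebras ?R S \<sigma> \<Omega>"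
    by (simp add: stable_subalgebras_def unital_subalgebra_def)
  from stable_closure_least[OF this] show ?thesis
    by (auto simp: assms(6) T_def)
qed

end
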